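(* Let $t\ge 2$ be an integer and let $n=T_t+2$, where $T_t=\frac{t(t+1)}{2}$. Then \[ \Delta_n=t(t-1)+2, \] and the unique vertex of $G_n$ of degree $\Delta_n$ is \[ \delta_t^{\mathrm{tb}}=(t+1,t-1,t-2,\dots,2,1,1). \] In particular, $m_\Delta(T_t+2)=1$.
   Context: A partition $\lambda\vdash n$ is a finite nonincreasing sequence of positive integers with sum $n$. The partition graph $G_n$ ($n\ge 1$) is the simple graph whose vertices are the partitions of $n$; two distinct partitions are adjacent if one is obtained from the other by an elementary transfer of one unit between two parts, followed by reordering: one part is decreased by $1$ and another part is increased by $1$. Here the receiving part may be an empty part of size $0$ (so that a new part $1$ is created), and a part that becomes $0$ is discarded. $\deg(\lambda)$ denotes the degree of the vertex $\lambda$ in $G_n$, $\Delta_n:=\max_{\lambda\vdash n}\deg(\lambda)$, and $m_\Delta(n):=|\{\lambda\vdash n:\deg(\lambda)=\Delta_n\}|$. The partition $\delta_t^{\mathrm{tb}}$ is obtained from the staircase $(t,t-1,\dots,1)$ by increasing the largest part by $1$ and adjoining one additional part equal to $1$ (for $t=2$ it is $(3,1,1)$). *)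

theory Defs
  imports "HOL-Library.Multiset"
begin

definition partitions :: "nat \<Rightarrow> nat list set" where
  "partitions n = {xs. sorted_wrt (\<ge>) xs \<and> (\<forall>x\<in>set xs. 0 < x) \<and> sum_list xs = n}"

text \<open>The appended 0 is the empty part: index \<open>length xs\<close> may receive the unit but not
  give it. Comparing multisets expresses the reordering.\<close>

definition elementary_transfer :: "nat list \<Rightarrow> nat list \<Rightarrow> bool" where
  "elementary_transfer xs ys \<longleftrightarrow>
     (\<exists>i j. i < length xs \<and> j \<le> length xs \<and> i \<noteq> j \<and>
        (let ps = xs @ [0]
         in mset ys = mset (filter (\<lambda>x. 0 < x) (ps[i := ps ! i - 1, j := ps ! j + 1]))))"

definition adjacent :: "nat \<Rightarrow> nat list \<Rightarrow> nat list \<Rightarrow> bool" where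
  "adjacent n xs ys \<longleftrightarrow> xs \<in> partitions n \<and> ys \<in> partitions n \<and> xs \<noteq> ys \<and>
     (elementary_transfer xs ys \<or> elementary_transfer ys xs)"

definition degree :: "nat \<Rightarrow> nat list \<Rightarrow> nat" where
  "degree n xs = card {ys. adjacent n xs ys}"

definition max_degree :: "nat \<Rightarrow> nat" where
  "max_degree n = Max (degree n ` partitions n)"

definition num_max_degree :: "nat \<Rightarrow> nat" where
  "num_max_degree n = card {xs \<in> partitions n. degree n xs = max_degree n}"

definition triangular :: "nat \<Rightarrow> nat" where
  "triangular t = t * (t + 1) div 2"

definition staircase :: "nat \<Rightarrow> nat list" where
  "staircase t = rev [1..<t + 1]"

definition delta_tb :: "nat \<Rightarrow> nat list" where
  "delta_tb t = (staircase t)[0 := staircase t ! 0 + 1] @ [1]"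

text \<open>Finiteness makes \<^const>\<open>card\<close> and \<^const>\<open>Max\<close> above meaningful.\<close>

lemma finite_partitions: "finite (partitions n)"
proof (rule finite_subset)
  have len: "length xs \<le> sum_list xs" if "\<forall>x\<in>set xs. 0 < x" for xs :: "nat list"
    using that by (induction xs) auto
  show "partitions n \<subseteq> {xs. set xs \<subseteq> {..n} \<and> length xs \<le> n}"
    using len by (auto simp: partitions_def intro: member_le_sum_list)
  show "finite {xs. set xs \<subseteq> {..n} \<and> length xs \<le> n}"
    by (rule finite_lists_length_le) simp
qed

lemma partitions_nonempty: "partitions n \<noteq> {}"
proof -
  have "replicate n 1 \<in> partitions n"
    by (auto simp: partitions_def sorted_wrt_iff_nth_less sum_list_replicate)
  then show ?thesis by blast
qed

lemma finite_neighbours: "finite {ys. adjacent n xs ys}"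
  by (rule finite_subset[OF _ finite_partitions[of n]]) (auto simp: adjacent_def)

end

theory Submission
  imports Defs
begin

text \<open>Let \<open>\<lambda>\<close> have \<open>d\<close> distinct part sizes, forming the set \<open>D\<close>. A transfer is determined by the
  size \<open>a \<in> D\<close> of the donor and the size \<open>b \<in> D \<union> {0}\<close> of the receiver; \<open>a = b\<close> needs a repeated
  part. On the conjugate partition (the numbers of parts of size at least \<open>k\<close>, for \<open>k \<ge> 1\<close>) it acts
  by lowering entry \<open>a\<close> and raising entry \<open>b + 1\<close>. Hence it is trivial exactly when \<open>a = b + 1\<close>, and
  distinct nontrivial transfers lead to distinct neighbours. Counting the pairs \<open>(a, b)\<close> gives

  \<open>deg \<lambda> = d (d - 1) + g + r\<close>,

  where \<open>g\<close> is the number of gaps (sizes \<open>a \<in> D\<close> with \<open>a - 1 \<notin> D \<union> {0}\<close>) and \<open>r\<close> is the number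
  of repeated sizes; see \<open>card_neighbours\<close> and \<open>degree_eq\<close>.

  A set of \<open>d\<close> positive integers with \<open>g\<close> gaps has sum at least \<open>T\<^sub>d + T\<^sub>g\<close>
  (\<open>triangular_gaps_le_sum\<close>), and the surplus copies of the \<open>r\<close> repeated sizes add at least
  \<open>T\<^sub>r\<close>. Since the sum
  is \<open>T\<^sub>t + 2\<close> and \<open>t \<ge> 2\<close>, there are \<open>d \<le> t\<close> sizes. If \<open>d < t\<close>, the trivial bounds
  \<open>g, r \<le> d\<close> give a degree of at most \<open>t (t - 1)\<close>. If \<open>d = t\<close>, then \<open>T\<^sub>g + T\<^sub>r \<le> 2\<close>, so
  \<open>g, r \<le> 1\<close> and the degree is at most \<open>t (t - 1) + 2\<close>. Equality forces \<open>D\<close> to have sum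
  \<open>T\<^sub>t + 1\<close>, that is \<open>D = {1, \<dots>, t - 1, t + 1}\<close>, and the surplus copies to have sum \<open>1\<close>.\<close>

section \<open>Transfers on multisets\<close>

text \<open>The contribution of a possibly empty part to the multiset of positive parts.\<close>

definition as_part :: "nat \<Rightarrow> nat multiset" where
  "as_part b = (if b = 0 then {#} else {#b#})"

text \<open>The donor has size \<open>Suc c\<close> and the receiver has size \<open>b\<close>; \<open>K\<close> consists of the parts that do not
  take part in the transfer. In this form the relation is visibly symmetric.\<close>

definition mset_transfer :: "nat multiset \<Rightarrow> nat multiset \<Rightarrow> bool" where
  "mset_transfer M N \<longleftrightarrow>
     (\<exists>K b c. M = add_mset (Suc c) (K + as_part b) \<and> N = add_mset (Suc b) (K + as_part c))"

lemma mset_transfer_sym: "mset_transfer M N \<Longrightarrow> mset_transfer N M"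
  unfolding mset_transfer_def by blast

lemma mset_transfer_pos:
  assumes "mset_transfer M N" "0 \<notin># M"
  shows "0 \<notin># N"
  using assms by (auto simp: mset_transfer_def as_part_def split: if_splits)

lemma mset_transfer_sum:
  assumes "mset_transfer M N"
  shows "\<Sum>\<^sub># N = \<Sum>\<^sub># M"
  using assms by (auto simp: mset_transfer_def as_part_def)

lemma filter_pos_id: "0 \<notin># M \<Longrightarrow> filter_mset (\<lambda>x::nat. 0 < x) M = M"
  by (rule filter_mset_cong[where g = "\<lambda>_. True", simplified, THEN trans]) (auto intro: gr0I)

lemma mset_update_two:
  assumes "i < length ps" "j < length ps" "i \<noteq> j"
  obtains K where "mset ps = add_mset (ps ! i) (add_mset (ps ! j) K)"
    and "\<And>u v. mset (ps[i := u, j := v]) = add_mset u (add_mset v K)"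
proof
  define I where "I = {..<length ps} - {i, j}"
  have split: "{..<length ps} = insert i (insert j I)" "finite I" "i \<notin> insert j I" "j \<notin> I"
    using assms by (auto simp: I_def)
  have mset_nth: "mset qs = image_mset ((!) qs) (mset_set {..<length qs})" for qs :: "'a list"
    by (metis atLeast0LessThan map_nth mset_map mset_upt)
  show "mset ps = add_mset (ps ! i) (add_mset (ps ! j) (image_mset ((!) ps) (mset_set I)))"
    using split by (subst mset_nth) simp
  show "mset (ps[i := u, j := v]) = add_mset u (add_mset v (image_mset ((!) ps) (mset_set I)))" for u v
  proof -
    have "image_mset ((!) (ps[i := u, j := v])) (mset_set I) = image_mset ((!) ps) (mset_set I)"
    proof (rule image_mset_cong)
      fix k assume "k \<in># mset_set I"
      then have "k \<noteq> i" "k \<noteq> j"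
        by (auto simp: I_def)
      then show "ps[i := u, j := v] ! k = ps ! k"
        by simp
    qed
    then show ?thesis
      using split assms by (subst mset_nth) simp
  qed
qed

lemma elementary_transfer_iff:
  assumes pos: "0 \<notin> set xs"
  shows "elementary_transfer xs ys \<longleftrightarrow> mset_transfer (mset xs) (mset ys)"
proof
  define ps where "ps = xs @ [0]"
  let ?pos = "filter_mset (\<lambda>x::nat. 0 < x)"
  have filter_ps: "?pos (mset ps) = mset xs"
    using pos by (simp add: ps_def filter_pos_id)
  {
    assume "elementary_transfer xs ys"
    then obtain i j where ij: "i < length xs" "j \<le> length xs" "i \<noteq> j"
      and ys: "mset ys = ?pos (mset (ps[i := ps ! i - 1, j := ps ! j + 1]))"
      unfolding elementary_transfer_def Let_def ps_def by (metis mset_filter)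
    obtain K where K: "mset ps = add_mset (ps ! i) (add_mset (ps ! j) K)"
      "\<And>u v. mset (ps[i := u, j := v]) = add_mset u (add_mset v K)"
      using mset_update_two[of i ps j] ij by (auto simp: ps_def)
    have "ps ! i \<noteq> 0"
      using pos ij by (metis nth_append nth_mem ps_def)
    then obtain c where c: "ps ! i = Suc c"
      using not0_implies_Suc by blast
    have "mset xs = add_mset (Suc c) (?pos K + as_part (ps ! j))"
      using filter_ps by (simp add: K(1) c as_part_def split: if_splits)
    moreover have "mset ys = add_mset (Suc (ps ! j)) (?pos K + as_part c)"
      using ys by (simp add: K(2) c as_part_def add_mset_commute)
    ultimately show "mset_transfer (mset xs) (mset ys)"
      unfolding mset_transfer_def by blast
  }
  assume "mset_transfer (mset xs) (mset ys)"
  then obtain K b c where xs: "mset xs = add_mset (Suc c) (K + as_part b)"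
    and ys: "mset ys = add_mset (Suc b) (K + as_part c)"
    unfolding mset_transfer_def by blast
  \<comment> \<open>For \<open>b = 0\<close> the receiver is the appended empty part; otherwise that part stays idle.\<close>
  define L where "L = (if b = 0 then K else add_mset 0 K)"
  have ps: "mset ps = add_mset (Suc c) (add_mset b L)"
    by (simp add: ps_def xs L_def as_part_def)
  have posL: "?pos L = K"
    using filter_ps by (simp add: ps xs as_part_def split: if_splits)
  have "Suc c \<in> set ps"
    using ps by (metis set_mset_mset union_single_eq_member)
  then obtain i where i: "i < length ps" "ps ! i = Suc c"
    by (auto simp: in_set_conv_nth)
  \<comment> \<open>Overwriting entry \<open>i\<close> by a value other than \<open>b\<close> keeps it from being found again as the
    receiver.\<close>
  have "mset (ps[i := Suc b]) = add_mset (Suc b) (add_mset b L)"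
    using i by (simp add: mset_update ps)
  then have "b \<in> set (ps[i := Suc b])"
    by (metis set_mset_mset insert_iff set_mset_add_mset_insert)
  then obtain j where j: "j < length ps" "ps[i := Suc b] ! j = b"
    by (auto simp: in_set_conv_nth)
  have "i \<noteq> j"
    using i j by auto
  then have psj: "ps ! j = b"
    using j by simp
  have "i < length xs"
    using i by (auto simp: ps_def nth_append split: if_splits)
  moreover have "j \<le> length xs"
    using j by (simp add: ps_def)
  moreover have "mset ys = mset (filter (\<lambda>x. 0 < x) (ps[i := ps ! i - 1, j := ps ! j + 1]))"
  proof -
    obtain L' where L': "mset ps = add_mset (ps ! i) (add_mset (ps ! j) L')"
      "\<And>u v. mset (ps[i := u, j := v]) = add_mset u (add_mset v L')"
      using mset_update_two[of i ps j] i j \<open>i \<noteq> j\<close> by metis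
    have "L' = L"
      using L'(1) by (simp add: ps i psj)
    then show ?thesis
      using posL by (simp add: L'(2) i psj ys as_part_def add_mset_commute)
  qed
  ultimately show "elementary_transfer xs ys"
    unfolding elementary_transfer_def Let_def ps_def[symmetric] using \<open>i \<noteq> j\<close> by blast
qed

lemma partitions_pos: "xs \<in> partitions n \<Longrightarrow> 0 \<notin> set xs"
  by (auto simp: partitions_def)

lemma partitions_mset_inj:
  assumes "xs \<in> partitions n" "ys \<in> partitions n" "mset xs = mset ys"
  shows "xs = ys"
proof -
  have "sorted (rev xs)" "sorted (rev ys)"
    using assms by (auto simp: partitions_def sorted_wrt_rev)
  then have "rev xs = rev ys"
    using assms(3) by (metis mset_rev properties_for_sort)
  then show ?thesis by simp
qed

lemma partition_of_mset:
  assumes "0 \<notin># M"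
  shows "\<exists>xs \<in> partitions (\<Sum>\<^sub># M). mset xs = M"
proof
  let ?xs = "rev (sorted_list_of_multiset M)"
  show m: "mset ?xs = M" by simp
  have "sum_list ?xs = \<Sum>\<^sub># M"
    using m by (metis sum_mset_sum_list)
  then show "?xs \<in> partitions (\<Sum>\<^sub># M)"
    using assms by (auto simp: partitions_def sorted_wrt_rev intro: gr0I)
qed

text \<open>Partitions correspond to multisets of positive numbers, and the transfer relation is symmetric,
  so both directions of adjacency collapse to one relation on multisets.\<close>

lemma degree_eq_card_neighbours:
  assumes xs: "xs \<in> partitions n"
  shows "degree n xs = card {N. mset_transfer (mset xs) N \<and> N \<noteq> mset xs}"
  unfolding degree_def
proof (rule bij_betw_same_card[of mset], rule bij_betw_imageI)
  have adj: "adjacent n xs ys \<longleftrightarrow>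
      ys \<in> partitions n \<and> mset_transfer (mset xs) (mset ys) \<and> mset ys \<noteq> mset xs" for ys
  proof (cases "ys \<in> partitions n")
    case True
    have "elementary_transfer xs ys \<or> elementary_transfer ys xs \<longleftrightarrow> mset_transfer (mset xs) (mset ys)"
      unfolding elementary_transfer_iff[OF partitions_pos[OF xs]]
        elementary_transfer_iff[OF partitions_pos[OF True]]
      using mset_transfer_sym by blast
    moreover have "xs = ys \<longleftrightarrow> mset ys = mset xs"
      using partitions_mset_inj[OF xs True] by metis
    ultimately show ?thesis
      unfolding adjacent_def using xs by blast
  qed (simp add: adjacent_def)
  show "inj_on mset {ys. adjacent n xs ys}"
    by (auto simp: adj inj_on_def intro: partitions_mset_inj)
  show "mset ` {ys. adjacent n xs ys} = {N. mset_transfer (mset xs) N \<and> N \<noteq> mset xs}"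
  proof (intro equalityI subsetI)
    fix N assume "N \<in> {N. mset_transfer (mset xs) N \<and> N \<noteq> mset xs}"
    then have N: "mset_transfer (mset xs) N" "N \<noteq> mset xs" by auto
    have "\<Sum>\<^sub># N = n"
      using mset_transfer_sum[OF N(1)] xs by (simp add: partitions_def sum_mset_sum_list)
    moreover have "0 \<notin># N"
      using mset_transfer_pos[OF N(1)] partitions_pos[OF xs] by simp
    ultimately obtain ys where "ys \<in> partitions n" "mset ys = N"
      using partition_of_mset[of N] by auto
    then show "N \<in> mset ` {ys. adjacent n xs ys}"
      using N by (auto simp: adj intro!: image_eqI[of _ _ ys])
  qed (auto simp: adj)
qed

section \<open>The degree formula\<close>

text \<open>The entry with index \<open>k\<close> of the conjugate partition.\<close>

definition parts_ge :: "nat \<Rightarrow> nat multiset \<Rightarrow> nat" where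
  "parts_ge k M = size (filter_mset (\<lambda>x. k \<le> x) M)"

text \<open>The equation determines \<open>c\<close> and \<open>b\<close> from \<open>M\<close> and \<open>N\<close> unless \<open>b = c\<close>, which gives the injectivity
  needed to count neighbours.\<close>

lemma parts_ge_transfer:
  assumes "M = add_mset (Suc c) (K + as_part b)" "N = add_mset (Suc b) (K + as_part c)" "0 < k"
  shows "parts_ge k N + of_bool (k = Suc c) = parts_ge k M + of_bool (k = Suc b)"
  using assms by (auto simp: parts_ge_def as_part_def)

text \<open>The neighbours of \<open>M\<close> correspond to the pairs consisting of the donor size \<open>Suc c\<close> and the
  receiver size \<open>b\<close>.\<close>

lemma card_neighbours_eq_card_pairs:
  "card {N. mset_transfer M N \<and> N \<noteq> M} =
    card {(c, b). Suc c \<in># M \<and> b \<noteq> c \<and> (b = 0 \<or> b \<in># M - {#Suc c#})}"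
    (is "card ?N = card ?P")
proof -
  define F where "F = (\<lambda>(c, b). add_mset (Suc b) (M - {#Suc c#} - as_part b + as_part c))"
  have dec: "M = add_mset (Suc c) ((M - {#Suc c#} - as_part b) + as_part b)"
    if "Suc c \<in># M" "b = 0 \<or> b \<in># M - {#Suc c#}" for c b
    using that by (auto simp: as_part_def simp del: diff_diff_add_mset diff_add_mset_swap)
  have ge: "parts_ge k (F (c, b)) + of_bool (k = Suc c) = parts_ge k M + of_bool (k = Suc b)"
    if "(c, b) \<in> ?P" "0 < k" for c b k
    using parts_ge_transfer[OF dec[of c b] _ \<open>0 < k\<close>, of "F (c, b)"] that by (simp add: F_def)
  have ne: "F (c, b) \<noteq> M" if "(c, b) \<in> ?P" for c b
    using ge[OF that, of "Suc c"] that by auto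
  have "inj_on F ?P"
  proof (rule inj_onI, clarify)
    fix c b c' b'
    assume P: "Suc c \<in># M" "b \<noteq> c" "b = 0 \<or> b \<in># M - {#Suc c#}"
      "Suc c' \<in># M" "b' \<noteq> c'" "b' = 0 \<or> b' \<in># M - {#Suc c'#}" and eq: "F (c, b) = F (c', b')"
    have "of_bool (k = Suc b) + of_bool (k = Suc c') = (of_bool (k = Suc b') + of_bool (k = Suc c) :: nat)"
      if "0 < k" for k
      using ge[of c b k] ge[of c' b' k] P eq that by simp
    from this[of "Suc c"] this[of "Suc b"] show "c = c' \<and> b = b'"
      using P by (auto split: if_splits simp: of_bool_def)
  qed
  moreover have "F ` ?P = ?N"
  proof (intro equalityI subsetI)
    fix N assume "N \<in> F ` ?P"
    then obtain c b where cb: "(c, b) \<in> ?P" "N = F (c, b)" by auto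
    then show "N \<in> ?N"
      using ne[OF cb(1)] dec[of c b] by (auto simp: mset_transfer_def F_def)
  next
    fix N assume "N \<in> ?N"
    then obtain K b c where K: "M = add_mset (Suc c) (K + as_part b)"
      "N = add_mset (Suc b) (K + as_part c)" "N \<noteq> M"
      by (auto simp: mset_transfer_def)
    then have "(c, b) \<in> ?P" "N = F (c, b)"
      by (auto simp: F_def as_part_def split: if_splits)
    then show "N \<in> F ` ?P" by blast
  qed
  ultimately show ?thesis
    using card_image by fastforce
qed

text \<open>The elements of \<open>D\<close> whose predecessor is neither \<open>0\<close> nor in \<open>D\<close>. For positive \<open>D\<close> these are
  the elements before which the increasing enumeration of \<open>{0} \<union> D\<close> skips a number.\<close>

definition gaps :: "nat set \<Rightarrow> nat set" where
  "gaps D = {a \<in> D. a \<noteq> 1 \<and> a - 1 \<notin> D}"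

text \<open>The part sizes of multiplicity at least two, which can both give and receive in one transfer.\<close>

definition repeated :: "nat multiset \<Rightarrow> nat set" where
  "repeated M = {a. 2 \<le> count M a}"

lemma repeated_subset: "repeated M \<subseteq> set_mset M"
  by (auto simp: repeated_def simp flip: count_greater_zero_iff)

lemma card_neighbours:
  assumes pos: "0 \<notin># M"
  defines "d \<equiv> card (set_mset M)"
  shows "card {N. mset_transfer M N \<and> N \<noteq> M} =
    d * (d - 1) + card (gaps (set_mset M)) + card (repeated M)"
proof -
  let ?D = "set_mset M"
  define R where "R a = {b. b \<noteq> a - 1 \<and> (b = 0 \<or> b \<in># M - {#a#})}" for a
  have R: "card (R a) = (d - 1) + of_bool (a \<in> gaps ?D) + of_bool (a \<in> repeated M)"
    if a: "a \<in> ?D" for a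
  proof -
    \<comment> \<open>The receivers form \<open>{0} \<union> D\<close> without \<open>a - 1\<close>, and without \<open>a\<close> if \<open>a\<close> is not repeated.\<close>
    define X where "X = insert 0 ?D"
    have X: "finite X" "card X = Suc d"
      using pos by (auto simp: X_def d_def)
    have "0 < d" using a by (auto simp: d_def card_gt_0_iff)
    have "a \<in> X" "0 < a" using a pos by (auto simp: X_def intro: gr0I)
    have mem: "b \<in># M - {#a#} \<longleftrightarrow> b \<in># M \<and> (b = a \<longrightarrow> a \<in> repeated M)" for b
      by (auto simp: repeated_def in_diff_count simp flip: count_greater_zero_iff)
    have "R a = X - {a - 1} - (if a \<in> repeated M then {} else {a})"
      using \<open>0 < a\<close> by (auto simp: R_def X_def mem)
    moreover have "a - 1 \<in> X \<longleftrightarrow> a \<notin> gaps ?D"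
      using a \<open>0 < a\<close> by (auto simp: X_def gaps_def)
    moreover have "card (X - {a - 1} - {a}) = card (X - {a - 1}) - 1"
      using \<open>a \<in> X\<close> \<open>0 < a\<close> by (intro card_Diff_singleton) simp
    moreover have "card (X - {a - 1}) = d + of_bool (a - 1 \<notin> X)"
      using X by (simp add: card_Diff_singleton_if)
    ultimately show ?thesis
      using \<open>0 < d\<close> by (cases "a \<in> repeated M") simp_all
  qed
  have finR: "finite (R a)" for a
    by (rule finite_subset[of _ "insert 0 ?D"]) (auto simp: R_def dest: in_diffD)
  have "bij_betw (\<lambda>(c, b). (Suc c, b))
      {(c, b). Suc c \<in># M \<and> b \<noteq> c \<and> (b = 0 \<or> b \<in># M - {#Suc c#})} (SIGMA a:?D. R a)"
  proof (rule bij_betw_byWitness[where f' = "\<lambda>(a, b). (a - 1, b)"])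
    have "Suc (a - 1) = a" if "a \<in># M" for a
      using that pos by (cases a) auto
    then show "\<forall>y \<in> SIGMA a:?D. R a. (\<lambda>(c, b). (Suc c, b)) ((\<lambda>(a, b). (a - 1, b)) y) = y"
      and "(\<lambda>(a, b). (a - 1, b)) ` (SIGMA a:?D. R a) \<subseteq>
        {(c, b). Suc c \<in># M \<and> b \<noteq> c \<and> (b = 0 \<or> b \<in># M - {#Suc c#})}"
      by (auto simp: R_def)
  qed (auto simp: R_def)
  then have "card {N. mset_transfer M N \<and> N \<noteq> M} = (\<Sum>a\<in>?D. card (R a))"
    by (simp add: card_neighbours_eq_card_pairs bij_betw_same_card finR)
  also have "\<dots> = (\<Sum>a\<in>?D. (d - 1) + of_bool (a \<in> gaps ?D) + of_bool (a \<in> repeated M))"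
    by (rule sum.cong) (auto simp: R)
  also have "\<dots> = d * (d - 1) + card (?D \<inter> gaps ?D) + card (?D \<inter> repeated M)"
    by (simp add: sum.distrib d_def Int_def)
  also have "?D \<inter> gaps ?D = gaps ?D"
    by (auto simp: gaps_def)
  also have "?D \<inter> repeated M = repeated M"
    using repeated_subset by blast
  finally show ?thesis .
qed

lemma degree_eq:
  assumes "xs \<in> partitions n"
  shows "degree n xs =
    card (set xs) * (card (set xs) - 1) + card (gaps (set xs)) + card (repeated (mset xs))"
  using degree_eq_card_neighbours[OF assms] card_neighbours[of "mset xs"] partitions_pos[OF assms]
  by simp

section \<open>Sums of sets of positive integers\<close>

lemma triangular_0 [simp]: "triangular 0 = 0"
  by (simp add: triangular_def)

lemma triangular_Suc [simp]: "triangular (Suc t) = triangular t + Suc t"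
  by (simp add: triangular_def)

lemma triangular_mono: "m \<le> n \<Longrightarrow> triangular m \<le> triangular n"
  unfolding triangular_def by (intro div_le_mono mult_le_mono) auto

lemma triangular_eq_sum: "triangular t = \<Sum>{1..t}"
  by (induction t) auto

text \<open>The largest element \<open>m\<close> satisfies \<open>m \<ge> d + g\<close>, because the predecessors of the gaps are \<open>g\<close>
  elements of \<open>{1..m}\<close> outside \<open>D\<close>; removing \<open>m\<close> destroys at most one gap.\<close>

lemma triangular_gaps_le_sum:
  assumes "finite D" "0 \<notin> D"
  shows "triangular (card D) + triangular (card (gaps D)) \<le> \<Sum>D"
  using assms
proof (induction D rule: finite_linorder_max_induct)
  case empty
  then show ?case by (simp add: gaps_def)
next
  case (insert m D)
  let ?D = "insert m D"
  have fin: "finite (gaps ?D)" "finite (gaps D)"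
    using insert.hyps by (auto simp: gaps_def)
  have "m \<notin> D" using insert.hyps by auto
  have "card (?D \<union> (\<lambda>a. a - 1) ` gaps ?D) \<le> card {1..m}"
  proof (rule card_mono)
    have "1 \<le> x \<and> x \<le> m" if "x \<in> ?D" for x
      using that insert.hyps insert.prems by (cases x) (auto intro: less_imp_le)
    moreover have "1 \<le> a - 1 \<and> a - 1 \<le> m" if "a \<in> gaps ?D" for a
      using that insert.hyps insert.prems by (cases a) (auto simp: gaps_def Suc_le_eq dest: less_imp_le)
    ultimately show "?D \<union> (\<lambda>a. a - 1) ` gaps ?D \<subseteq> {1..m}"
      by auto
  qed simp
  moreover have "inj_on (\<lambda>a. a - 1) (gaps ?D)"
    using insert.prems by (auto simp: inj_on_def gaps_def)
  ultimately have m: "card ?D + card (gaps ?D) \<le> m"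
    using insert.hyps fin
    by (subst (asm) card_Un_disjoint) (auto simp: card_image gaps_def)
  have "gaps ?D \<subseteq> insert m (gaps D)"
    by (auto simp: gaps_def)
  then have "card (gaps ?D) \<le> Suc (card (gaps D))"
    using fin card_mono[of "insert m (gaps D)" "gaps ?D"] by (auto simp: card_insert_if split: if_splits)
  then have "triangular (card (gaps ?D)) \<le> triangular (card (gaps D)) + card (gaps ?D)"
    using triangular_mono[of "card (gaps ?D) - 1" "card (gaps D)"]
    by (cases "card (gaps ?D)") auto
  then show ?case
    using insert m \<open>m \<notin> D\<close> by auto
qed

lemma triangular_le_sum:
  assumes "finite D" "0 \<notin> D"
  shows "triangular (card D) \<le> \<Sum>D"
  using triangular_gaps_le_sum[OF assms] by simp

text \<open>Removing an element \<open>m\<close> leaves a sum of at least \<open>T\<^bsub>t - 1\<^esub>\<close>, so \<open>m \<le> t + 1\<close>.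
  Thus \<open>D\<close> lies in \<open>{1..t + 1}\<close> and misses exactly one element of it, which the sum determines.\<close>

lemma set_eq_of_sum_eq_Suc_triangular:
  assumes fin: "finite D" and pos: "0 \<notin> D" and card: "card D = t" and sum: "\<Sum>D = triangular t + 1"
  shows "D = {1..t + 1} - {t}"
proof -
  have "m \<le> t + 1" if "m \<in> D" for m
  proof -
    have "triangular (t - 1) \<le> \<Sum>(D - {m})"
      using triangular_le_sum[of "D - {m}"] that fin pos card by simp
    moreover have "\<Sum>D = m + \<Sum>(D - {m})"
      using that fin by (simp add: sum.remove)
    moreover have "0 < t" using that fin card by (auto simp: card_gt_0_iff)
    ultimately show ?thesis
      using sum triangular_Suc[of "t - 1"] by simp
  qed
  then have sub: "D \<subseteq> {1..t + 1}"
    using pos by (auto intro: gr0I simp: Suc_le_eq)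
  then have "card ({1..t + 1} - D) = 1"
    by (simp add: card_Diff_subset fin card)
  then obtain k where k: "{1..t + 1} - D = {k}"
    by (auto simp: card_1_singleton_iff)
  have "\<Sum>{1..t + 1} = \<Sum>({1..t + 1} - D) + \<Sum>D"
    by (rule sum.subset_diff[OF sub]) simp
  then have "triangular (Suc t) = k + triangular t + 1"
    unfolding triangular_eq_sum[symmetric] k sum by (simp add: triangular_eq_sum[symmetric])
  then have "k = t" by simp
  then show ?thesis using k sub by blast
qed

section \<open>Partitions of a triangular number plus two\<close>

lemma delta_tb_eq:
  assumes "t \<ge> 2"
  shows "delta_tb t = (t + 1) # rev [1..<t] @ [1]"
  using assms by (simp add: delta_tb_def staircase_def)

lemma mset_delta_tb:
  assumes "t \<ge> 2"
  shows "mset (delta_tb t) = add_mset 1 (mset_set ({1..t + 1} - {t}))"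
proof -
  have "{1..t + 1} - {t} = insert (t + 1) {1..<t}" using assms by auto
  then show ?thesis using assms by (simp add: delta_tb_eq add_mset_commute)
qed

lemma delta_tb_partition:
  assumes "t \<ge> 2"
  shows "delta_tb t \<in> partitions (triangular t + 2)"
proof -
  have "\<Sum>{1..t} = t + \<Sum>{1..<t}"
    using assms by (simp add: sum.last_plus)
  then have "sum_list (delta_tb t) = triangular t + 2"
    using assms by (simp add: delta_tb_eq triangular_eq_sum sum_list_distinct_conv_sum_set)
  then show ?thesis
    using assms by (auto simp: partitions_def delta_tb_eq sorted_wrt_append sorted_wrt_rev
      intro: sorted_wrt_mono_rel[OF _ sorted_upt])
qed

lemma degree_delta_tb:
  assumes "t \<ge> 2"
  shows "degree (triangular t + 2) (delta_tb t) = t * (t - 1) + 2"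
proof -
  have set: "set (delta_tb t) = {1..t + 1} - {t}"
    using assms by (auto simp: delta_tb_eq)
  have "gaps ({1..t + 1} - {t}) = {t + 1}"
    using assms by (auto simp: gaps_def)
  moreover have "repeated (mset (delta_tb t)) = {1}"
    using assms by (auto simp: mset_delta_tb repeated_def count_mset_set' split: if_splits)
  ultimately show ?thesis
    unfolding degree_eq[OF delta_tb_partition[OF assms]] set using assms by simp
qed

text \<open>Here \<open>R\<close> holds the surplus copies of repeated parts, so that its support is the set of repeated
  sizes and the sum of the partition splits as \<open>\<Sum>D + \<Sum>\<^sub># R\<close>.\<close>

lemma degree_le_and_unique:
  assumes t: "t \<ge> 2" and xs: "xs \<in> partitions (triangular t + 2)"
  shows "degree (triangular t + 2) xs \<le> t * (t - 1) + 2"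
    and "degree (triangular t + 2) xs = t * (t - 1) + 2 \<Longrightarrow> xs = delta_tb t"
proof -
  define D where "D = set xs"
  define R where "R = mset xs - mset_set D"
  define d g r where "d = card D" and "g = card (gaps D)" and "r = card (repeated (mset xs))"
  have fin: "finite D" and pos: "0 \<notin> D"
    using partitions_pos[OF xs] by (auto simp: D_def)
  have deg: "degree (triangular t + 2) xs = d * (d - 1) + g + r"
    unfolding degree_eq[OF xs] D_def d_def g_def r_def ..
  have split: "mset xs = mset_set D + R"
    unfolding R_def D_def by (simp add: mset_set_set_mset_msubset flip: set_mset_mset)
  have "\<Sum>\<^sub># (mset xs) = triangular t + 2"
    using xs by (simp add: partitions_def sum_mset_sum_list)
  then have total: "\<Sum>D + \<Sum>\<^sub># R = triangular t + 2"
    by (simp add: split sum_unfold_sum_mset)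
  have rep: "repeated (mset xs) = set_mset R"
  proof -
    have "a \<in> repeated (mset xs) \<longleftrightarrow> 0 < count R a" for a
    proof (cases "a \<in> set xs")
      case False
      then have "count (mset xs) a = 0"
        by (simp only: count_eq_zero_iff set_mset_mset not_False_eq_True)
      then have "a \<notin> repeated (mset xs)" "count R a = 0"
        by (simp_all only: repeated_def R_def count_diff mem_Collect_eq)
      then show ?thesis by simp
    qed (auto simp: repeated_def R_def D_def)
    then show ?thesis by auto
  qed
  have gD: "triangular d + triangular g \<le> \<Sum>D"
    using triangular_gaps_le_sum[OF fin pos] by (simp add: d_def g_def)
  have rR: "triangular r \<le> \<Sum>\<^sub># R"
  proof -
    have "R = mset_set (set_mset R) + (R - mset_set (set_mset R))"
      by (simp add: mset_set_set_mset_msubset)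
    then have "\<Sum>(set_mset R) \<le> \<Sum>\<^sub># R"
      by (metis le_add1 sum_mset.union sum_unfold_sum_mset image_mset.identity id_apply)
    moreover have "0 \<notin> set_mset R"
      using pos by (auto simp: R_def D_def dest: in_diffD)
    ultimately show ?thesis
      using triangular_le_sum[of "set_mset R"] by (simp add: r_def rep)
  qed
  have "d \<le> t"
  proof (rule ccontr)
    assume "\<not> d \<le> t"
    then have "triangular (Suc t) \<le> triangular d" by (intro triangular_mono) simp
    then show False using gD total t by simp
  qed
  have "degree (triangular t + 2) xs \<le> t * (t - 1) + 2 \<and>
    (degree (triangular t + 2) xs = t * (t - 1) + 2 \<longrightarrow> xs = delta_tb t)"
  proof (cases "d = t")
    case False
    have "g \<le> d" "r \<le> d"
      using fin repeated_subset[of "mset xs"]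
      by (auto simp: g_def r_def d_def gaps_def D_def intro!: card_mono)
    then have "d * (d - 1) + g + r \<le> d * (d + 1)"
      by (cases d) auto
    also have "\<dots> \<le> (t - 1) * t"
      using False \<open>d \<le> t\<close> by (intro mult_le_mono) auto
    finally show ?thesis using deg by (simp add: mult.commute)
  next
    case True
    have sum2: "triangular g + triangular r \<le> 2"
      using gD rR total True by simp
    have le1: "k \<le> 1" if "triangular k \<le> 2" for k
      using triangular_mono[of 2 k] that by (cases "k \<le> 1") (auto simp: numeral_2_eq_2)
    have gr: "g \<le> 1" "r \<le> 1"
      using le1 sum2 by auto
    moreover have "xs = delta_tb t" if g1: "g = 1" and r1: "r = 1"
    proof -
      have sums: "\<Sum>D = triangular t + 1" "\<Sum>\<^sub># R = 1"
        using gD rR total True g1 r1 by auto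
      obtain a where "set_mset R = {a}"
        using r1 by (auto simp: r_def rep card_1_singleton_iff)
      then obtain R' where R': "R = add_mset a R'"
        by (metis insertI1 insert_DiffM)
      have posR: "0 \<notin># R"
        using pos by (auto simp: R_def D_def dest: in_diffD)
      then have "0 < a" "a + \<Sum>\<^sub># R' = 1"
        using sums(2) by (auto simp: R')
      then have "a = 1" "\<Sum>\<^sub># R' = 0"
        by linarith+
      then have "R = {#1#}"
        using posR by (cases R') (auto simp: R')
      moreover have "D = {1..t + 1} - {t}"
        using set_eq_of_sum_eq_Suc_triangular[OF fin pos] True sums(1) by (simp add: d_def)
      ultimately have "mset xs = mset (delta_tb t)"
        by (simp add: split mset_delta_tb[OF t])
      then show ?thesis
        using partitions_mset_inj[OF xs delta_tb_partition[OF t]] by blast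
    qed
    ultimately show ?thesis
      using deg True by auto
  qed
  then show "degree (triangular t + 2) xs \<le> t * (t - 1) + 2"
    and "degree (triangular t + 2) xs = t * (t - 1) + 2 \<Longrightarrow> xs = delta_tb t"
    by auto
qed

theorem theorem3p12:
  fixes t n :: nat
  assumes "t \<ge> 2" and "n = triangular t + 2"
  shows "max_degree n = t * (t - 1) + 2
    \<and> {xs \<in> partitions n. degree n xs = max_degree n} = {delta_tb t}
    \<and> delta_tb t = (t + 1) # rev [1..<t] @ [1]
    \<and> num_max_degree n = 1"
proof -
  have part: "delta_tb t \<in> partitions n" and deg: "degree n (delta_tb t) = t * (t - 1) + 2"
    using delta_tb_partition degree_delta_tb assms by auto
  have bound: "degree n xs \<le> t * (t - 1) + 2" if "xs \<in> partitions n" for xs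
    using degree_le_and_unique(1) assms that by simp
  have max: "max_degree n = t * (t - 1) + 2"
    unfolding max_degree_def
  proof (rule Max_eqI)
    show "t * (t - 1) + 2 \<in> degree n ` partitions n"
      using part deg by (metis imageI)
  qed (auto simp: finite_partitions dest: bound)
  have "{xs \<in> partitions n. degree n xs = max_degree n} = {delta_tb t}"
      proof (intro equalityI subsetI)
    fix xs assume "xs \<in> {xs \<in> partitions n. degree n xs = max_degree n}"
    then show "xs \<in> {delta_tb t}"
      using degree_le_and_unique(2)[OF assms(1), of xs] max assms(2) by simp
  next
    fix xs assume "xs \<in> {delta_tb t}"
    then show "xs \<in> {xs \<in> partitions n. degree n xs = max_degree n}"
      using part deg max by simp
  qed
  then show ?thesis
    using max delta_tb_eq assms by (simp add: num_max_degree_def)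
qed

end
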